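(* Let $m$ be a positive integer and let $\alpha\in\mathbb{Z}_{\ge0}^n$ be a multi-index with $|\alpha|=m$. There exist real constants $C^\alpha_{\ell\beta\gamma}$ (indexed by $\beta,\gamma\in\mathbb{Z}_{\ge0}^n$ and $\ell\in\mathbb{Z}_{\geq 0}$ as in the second sum below), independent of $t$, $x$ and $\varphi$, such that for every $\varphi\in L^1_m(\mathbb{R}^n)$ and every $t>0$ one has $x^\alpha e^{t\Delta}\varphi\in L^1(\mathbb{R}^n)$ and the identity $$x^\alpha e^{t\Delta}\varphi-e^{t\Delta}x^\alpha\varphi=R_\alpha(t)\varphi$$ holds in $L^1(\mathbb{R}^n)$, where $$R_\alpha(t)\varphi:=\sum_{\substack{\beta+\gamma=\alpha\\ \beta\ne0}}\frac{\alpha!}{\beta!\,\gamma!}(-2t\partial)^\beta e^{t\Delta}x^\gamma\varphi+\sum_{\substack{\beta+\gamma\le\alpha,\ |\beta+\gamma|\le|\alpha|-2\\ |\beta|+1\le\ell\le\frac{|\alpha|+|\beta|-|\gamma|}{2}}}C^\alpha_{\ell\beta\gamma}\,t^\ell\,\partial^\beta e^{t\Delta}x^\gamma\varphi.$$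
   Context: $n\ge1$ is an integer. $e^{t\Delta}\varphi=G_t*\varphi$ for $t>0$, with $G_t(x)=(4\pi t)^{-n/2}\exp(-|x|^2/(4t))$, $x\in\mathbb{R}^n$. Standard multi-index notation is used ($|\alpha|=\sum\alpha_j$, $\alpha!=\prod\alpha_j!$, $x^\alpha=\prod x_j^{\alpha_j}$, $\partial^\alpha=\prod\partial_j^{\alpha_j}$; $\alpha\le\beta$ means $\alpha_j\le\beta_j$ for all $j$), and $(-2t\partial)^\beta=(-2t)^{|\beta|}\partial^\beta$. $x^\alpha\varphi$ denotes the function $x\mapsto x^\alpha\varphi(x)$; thus $e^{t\Delta}x^\gamma\varphi=e^{t\Delta}(x^\gamma\varphi)$ and $x^\alpha e^{t\Delta}\varphi=x^\alpha(e^{t\Delta}\varphi)$. $L^1_m(\mathbb{R}^n)=\{\varphi\in L^1(\mathbb{R}^n): x^\alpha\varphi\in L^1(\mathbb{R}^n)\text{ for all }\alpha\in\mathbb{Z}_{\ge0}^n\text{ with }|\alpha|\le m\}$. *)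

theory Defs
  imports "HOL-Analysis.Analysis" "HOL-Library.Function_Algebras"
begin

text \<open>Multi-indices are functions \<open>'n \<Rightarrow> nat\<close> on the index type of \<open>real ^ 'n\<close>, so that
  \<open>n = CARD('n)\<close>; sum, zero and order of multi-indices are the pointwise ones.
  Functions are complex-valued, which contains the real-valued case.\<close>

definition mi_size :: "('n::finite \<Rightarrow> nat) \<Rightarrow> nat"
  where "mi_size \<alpha> = (\<Sum>j\<in>UNIV. \<alpha> j)"

definition mi_fact :: "('n::finite \<Rightarrow> nat) \<Rightarrow> real"
  where "mi_fact \<alpha> = (\<Prod>j\<in>UNIV. fact (\<alpha> j))"

definition mi_pow :: "real ^ 'n \<Rightarrow> ('n::finite \<Rightarrow> nat) \<Rightarrow> real"
  where "mi_pow x \<alpha> = (\<Prod>j\<in>UNIV. (x $ j) ^ \<alpha> j)"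

definition mi_mult :: "('n::finite \<Rightarrow> nat) \<Rightarrow> (real ^ 'n \<Rightarrow> complex) \<Rightarrow> real ^ 'n \<Rightarrow> complex"
  where "mi_mult \<alpha> \<phi> = (\<lambda>x. mi_pow x \<alpha> *\<^sub>R \<phi> x)"

definition partial_deriv :: "'n::finite \<Rightarrow> (real ^ 'n \<Rightarrow> complex) \<Rightarrow> real ^ 'n \<Rightarrow> complex"
  where "partial_deriv j f = (\<lambda>x. vector_derivative (\<lambda>s. f (x + s *\<^sub>R axis j 1)) (at 0))"

text \<open>The index type carries no order, so the product of the powers of the partial derivatives
  is taken along some fixed enumeration of the coordinates. The choice is
  irrelevant for the smooth functions \<open>heat t \<psi>\<close> with \<open>\<psi>\<close> integrable and \<open>t > 0\<close>.\<close>

definition coords :: "'n::finite list"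
  where "coords = (SOME js. distinct js \<and> set js = UNIV)"

lemma coords: "distinct (coords :: 'n::finite list)" "set (coords :: 'n list) = UNIV"
proof -
  have "\<exists>js :: 'n list. distinct js \<and> set js = UNIV"
    using finite_distinct_list[of "UNIV :: 'n set"] by auto
  from someI_ex[OF this]
  show "distinct (coords :: 'n list)" "set (coords :: 'n list) = UNIV"
    unfolding coords_def by auto
qed

definition mi_deriv :: "('n::finite \<Rightarrow> nat) \<Rightarrow> (real ^ 'n \<Rightarrow> complex) \<Rightarrow> real ^ 'n \<Rightarrow> complex"
  where "mi_deriv \<beta> f = foldr (\<lambda>j. partial_deriv j ^^ \<beta> j) coords f"

definition heat_kernel :: "real \<Rightarrow> real ^ 'n::finite \<Rightarrow> real"
  where "heat_kernel t x =
    (4 * pi * t) powr (- real CARD('n) / 2) * exp (- (norm x)\<^sup>2 / (4 * t))"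

definition heat :: "real \<Rightarrow> (real ^ 'n::finite \<Rightarrow> complex) \<Rightarrow> real ^ 'n \<Rightarrow> complex"
  where "heat t \<phi> = (\<lambda>x. LINT y|lebesgue. heat_kernel t (x - y) *\<^sub>R \<phi> y)"

definition L1w :: "nat \<Rightarrow> (real ^ 'n::finite \<Rightarrow> complex) set"
  where "L1w m = {\<phi>. integrable lebesgue \<phi> \<and>
    (\<forall>\<alpha>. mi_size \<alpha> \<le> m \<longrightarrow> integrable lebesgue (mi_mult \<alpha> \<phi>))}"

definition idx_main :: "('n::finite \<Rightarrow> nat) \<Rightarrow> (('n \<Rightarrow> nat) \<times> ('n \<Rightarrow> nat)) set"
  where "idx_main \<alpha> = {(\<beta>, \<gamma>). \<beta> + \<gamma> = \<alpha> \<and> \<beta> \<noteq> 0}"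

text \<open>The constraints \<open>|\<beta> + \<gamma>| \<le> |\<alpha>| - 2\<close> and \<open>l \<le> (|\<alpha>| + |\<beta>| - |\<gamma>|) / 2\<close> are
  rearranged to avoid truncated subtraction and division.\<close>

definition idx_rest :: "('n::finite \<Rightarrow> nat) \<Rightarrow> (nat \<times> ('n \<Rightarrow> nat) \<times> ('n \<Rightarrow> nat)) set"
  where "idx_rest \<alpha> = {(l, \<beta>, \<gamma>). \<beta> + \<gamma> \<le> \<alpha> \<and> mi_size (\<beta> + \<gamma>) + 2 \<le> mi_size \<alpha> \<and>
    mi_size \<beta> + 1 \<le> l \<and> 2 * l + mi_size \<gamma> \<le> mi_size \<alpha> + mi_size \<beta>}"

lemma finite_mi_le: "finite {\<beta> :: 'n::finite \<Rightarrow> nat. \<beta> \<le> \<alpha>}"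
proof -
  have "{\<beta>. \<beta> \<le> \<alpha>} = Pi\<^sub>E UNIV (\<lambda>j. {..\<alpha> j})"
    by (simp add: le_fun_def PiE_def Pi_def)
  then show ?thesis
    by (simp add: finite_PiE)
qed

lemma mi_add_le:
  fixes \<beta> \<gamma> \<alpha> :: "'n::finite \<Rightarrow> nat"
  assumes "\<beta> + \<gamma> \<le> \<alpha>"
  shows "\<beta> \<le> \<alpha>" "\<gamma> \<le> \<alpha>" "mi_size \<beta> \<le> mi_size \<alpha>"
proof -
  have le: "\<beta> j + \<gamma> j \<le> \<alpha> j" for j
    using le_funD[OF assms, of j] by simp
  show "\<beta> \<le> \<alpha>"
    by (rule le_funI) (use le add_leD1 in blast)
  show "\<gamma> \<le> \<alpha>"
    by (rule le_funI) (use le add_leD2 in blast)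
  show "mi_size \<beta> \<le> mi_size \<alpha>"
    unfolding mi_size_def by (rule sum_mono) (use le add_leD1 in blast)
qed

lemma finite_idx_main: "finite (idx_main \<alpha>)"
proof (rule finite_subset)
  show "idx_main \<alpha> \<subseteq> {\<beta>. \<beta> \<le> \<alpha>} \<times> {\<gamma>. \<gamma> \<le> \<alpha>}"
    using mi_add_le(1,2) unfolding idx_main_def by fastforce
qed (simp add: finite_mi_le)

lemma finite_idx_rest: "finite (idx_rest \<alpha>)"
proof (rule finite_subset)
  show "idx_rest \<alpha> \<subseteq> {..2 * mi_size \<alpha>} \<times> {\<beta>. \<beta> \<le> \<alpha>} \<times> {\<gamma>. \<gamma> \<le> \<alpha>}"
  proof
    fix p assume "p \<in> idx_rest \<alpha>"
    then obtain l \<beta> \<gamma> where p: "p = (l, \<beta>, \<gamma>)" "\<beta> + \<gamma> \<le> \<alpha>"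
        "2 * l + mi_size \<gamma> \<le> mi_size \<alpha> + mi_size \<beta>"
      unfolding idx_rest_def by blast
    have "l \<le> 2 * mi_size \<alpha>"
      using p(3) mi_add_le(3)[OF p(2)] by linarith
    then show "p \<in> {..2 * mi_size \<alpha>} \<times> {\<beta>. \<beta> \<le> \<alpha>} \<times> {\<gamma>. \<gamma> \<le> \<alpha>}"
      using p(1) mi_add_le(1,2)[OF p(2)] by simp
  qed
qed (simp add: finite_mi_le)

definition remainder :: "(nat \<Rightarrow> ('n::finite \<Rightarrow> nat) \<Rightarrow> ('n \<Rightarrow> nat) \<Rightarrow> real) \<Rightarrow> ('n \<Rightarrow> nat) \<Rightarrow> real \<Rightarrow>
    (real ^ 'n \<Rightarrow> complex) \<Rightarrow> real ^ 'n \<Rightarrow> complex"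
  where "remainder C \<alpha> t \<phi> = (\<lambda>x.
    (\<Sum>(\<beta>, \<gamma>)\<in>idx_main \<alpha>. (mi_fact \<alpha> / (mi_fact \<beta> * mi_fact \<gamma>)) *\<^sub>R
        (- 2 * t) ^ mi_size \<beta> *\<^sub>R mi_deriv \<beta> (heat t (mi_mult \<gamma> \<phi>)) x) +
    (\<Sum>(l, \<beta>, \<gamma>)\<in>idx_rest \<alpha>. C l \<beta> \<gamma> *\<^sub>R t ^ l *\<^sub>R mi_deriv \<beta> (heat t (mi_mult \<gamma> \<phi>)) x))"

end

theory Submission
  imports Defs "HOL-Probability.Distributions"
begin

text \<open>The kernel \<open>\<partial>\<^sup>\<beta> G\<^sub>t\<close> is \<open>G\<^sub>t\<close> times a product of one-dimensional Hermite polynomials in the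
  coordinates. Writing \<open>x = (x - y) + y\<close> in each coordinate, the binomial theorem and the expansion
  of the powers of \<open>x - y\<close> in Hermite polynomials express \<open>x\<^sup>\<alpha> G\<^sub>t(x - y)\<close> as a linear combination
  of the functions \<open>t\<^sup>l (\<partial>\<^sup>\<beta> G\<^sub>t)(x - y) y\<^sup>\<gamma>\<close>; integrating against \<open>\<phi>(y)\<close> gives the identity pointwise.
  The terms with \<open>\<beta> + \<gamma> = \<alpha>\<close> come from the leading coefficients \<open>(- 2 t)\<^sup>k\<close>, and since Hermite
  polynomials are even or odd, every other term loses at least two orders.\<close>

subsection \<open>Hermite polynomials\<close>

text \<open>For t > 0 this is (-1)^k (4 t)^(-k/2) H_k(z / (2 sqrt t)) with the physicists' Hermite
  polynomial H_k, normalised so that \<open>hpoly t k\<close> times the Gaussian is its k-th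
  derivative.\<close>

fun hpoly :: "real \<Rightarrow> nat \<Rightarrow> real \<Rightarrow> real" where
  "hpoly t 0 z = 1"
| "hpoly t (Suc 0) z = - z / (2 * t)"
| "hpoly t (Suc (Suc k)) z = - (z * hpoly t (Suc k) z + real (Suc k) * hpoly t k z) / (2 * t)"

text \<open>The three-term recurrence solved for the product, so that multiplication by z becomes a
  shift of the index. At k = 0 the truncated \<open>k - 1\<close> is harmless because its factor is
  0.\<close>

lemma mult_hpoly:
  assumes "t > 0"
  shows "z * hpoly t k z = - 2 * t * hpoly t (Suc k) z - real k * hpoly t (k - 1) z"
  using assms by (cases k) (auto simp: field_simps)

lemma hpoly_has_real_derivative:
  assumes "t > 0"
  shows "(hpoly t k has_real_derivative - (real k / (2 * t)) * hpoly t (k - 1) z) (at z)"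
  using assms
proof (induction t k z rule: hpoly.induct)
  case (3 t k z)
  have rec: "hpoly t (Suc (Suc k)) =
      (\<lambda>z. - (z * hpoly t (Suc k) z + real (Suc k) * hpoly t k z) / (2 * t))"
    by (simp add: fun_eq_iff)
  have der: "((\<lambda>z. - (z * hpoly t (Suc k) z + real (Suc k) * hpoly t k z) / (2 * t))
      has_real_derivative
      - (1 * hpoly t (Suc k) z + (- (real (Suc k) / (2 * t)) * hpoly t k z) * z
        + real (Suc k) * (- (real k / (2 * t)) * hpoly t (k - 1) z)) / (2 * t)) (at z)"
    using 3 by (auto intro!: derivative_eq_intros simp: field_simps)
  have "- (1 * hpoly t (Suc k) z + (- (real (Suc k) / (2 * t)) * hpoly t k z) * z
        + real (Suc k) * (- (real k / (2 * t)) * hpoly t (k - 1) z)) / (2 * t)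
      = - (hpoly t (Suc k) z - real (Suc k) / (2 * t) *
          (z * hpoly t k z + real k * hpoly t (k - 1) z)) / (2 * t)"
    by (simp add: algebra_simps)
  \<comment> \<open>By the recurrence the bracket is -2 t \<open>hpoly t (Suc k) z\<close>; together
    with the first summand this gives 1 + (k + 1) copies.\<close>
  also have "\<dots> = - (real (Suc (Suc k)) / (2 * t)) * hpoly t (Suc k) z"
    unfolding mult_hpoly[OF 3(3)] using 3(3) by (simp add: field_simps)
  finally show ?case
    using der unfolding rec by (simp only: diff_Suc_1)
next
  case (1 t)
  have "hpoly t 0 = (\<lambda>z. 1)" by (simp add: fun_eq_iff)
  then show ?case by simp
next
  case (2 t)
  have "hpoly t (Suc 0) = (\<lambda>z. - z / (2 * t))" by (simp add: fun_eq_iff)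
  then show ?case using 2 by (auto intro!: derivative_eq_intros)
qed

text \<open>Variance 2 t makes this the one-dimensional heat kernel, and integrability is inherited
  from the normal density.\<close>

abbreviation gauss :: "real \<Rightarrow> real \<Rightarrow> real"
  where "gauss t \<equiv> normal_density 0 (sqrt (2 * t))"

lemma gauss_eq: "t > 0 \<Longrightarrow> gauss t z = 1 / sqrt (4 * pi * t) * exp (- z\<^sup>2 / (4 * t))"
  by (simp add: normal_density_def mult_ac)

text \<open>Differentiating the polynomial lowers its index and differentiating the Gaussian
  multiplies by -z / (2 t); the recurrence merges both into the next polynomial.\<close>

lemma hpoly_gauss_has_real_derivative:
  assumes "t > 0"
  shows "((\<lambda>z. hpoly t k z * gauss t z) has_real_derivative hpoly t (Suc k) z * gauss t z) (at z)"
proof -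
  have g: "(gauss t has_real_derivative - (z / (2 * t)) * gauss t z) (at z)"
    unfolding gauss_eq[OF assms, abs_def] using assms
    by (auto intro!: derivative_eq_intros simp: field_simps)
  have "((\<lambda>z. hpoly t k z * gauss t z) has_real_derivative
      - (real k / (2 * t)) * hpoly t (k - 1) z * gauss t z
      + - (z / (2 * t)) * gauss t z * hpoly t k z) (at z)"
    using DERIV_mult'[OF hpoly_has_real_derivative[OF assms] g] by (simp add: algebra_simps)
  moreover have "- (real k / (2 * t)) * hpoly t (k - 1) z * gauss t z
      + - (z / (2 * t)) * gauss t z * hpoly t k z
      = - (1 / (2 * t)) * gauss t z * (real k * hpoly t (k - 1) z + z * hpoly t k z)"
    by (simp add: algebra_simps)
  moreover have "\<dots> = hpoly t (Suc k) z * gauss t z"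
    unfolding mult_hpoly[OF assms] using assms by (simp add: field_simps)
  ultimately show ?thesis
    by simp
qed

section \<open>Gaussian bounds for Hermite polynomials\<close>

lemma power_le_exp_square:
  fixes t :: real
  assumes "t > 0"
  shows "\<exists>C. \<forall>s. \<bar>s\<bar> ^ p \<le> C * exp (s\<^sup>2 / (8 * t))"
proof (intro exI allI)
  fix s :: real
  \<comment> \<open>N is chosen so that the p-th power of exp(s^2 / N) stays below exp(s^2 / (8 t));
    \<open>Suc p\<close> keeps N positive when p = 0.\<close>
  define N where "N = 8 * t * real (Suc p)"
  have N: "N > 0" using assms by (simp add: N_def)
  have "\<bar>s\<bar> \<le> 1 + s\<^sup>2"
  proof (cases "\<bar>s\<bar> \<le> 1")
    case True
    then show ?thesis using zero_le_power2[of s] by linarith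
  next
    case False
    then show ?thesis using power_increasing[of 1 2 "\<bar>s\<bar>"] by simp
  qed
  also have "\<dots> = 1 + N * (s\<^sup>2 / N)" using N by simp
  also have "\<dots> \<le> (1 + N) * (1 + s\<^sup>2 / N)"
    using N by (simp add: distrib_left distrib_right add_divide_distrib)
  also have "\<dots> \<le> (1 + N) * exp (s\<^sup>2 / N)"
    using N by (intro mult_left_mono exp_ge_add_one_self) auto
  finally have "\<bar>s\<bar> ^ p \<le> ((1 + N) * exp (s\<^sup>2 / N)) ^ p"
    by (intro power_mono) auto
  also have "\<dots> = (1 + N) ^ p * exp (real p * (s\<^sup>2 / N))"
    by (simp only: power_mult_distrib exp_of_nat_mult)
  also have "real p * (s\<^sup>2 / N) \<le> s\<^sup>2 / (8 * t)"
  proof -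
    have "real p * (s\<^sup>2 / N) \<le> real (Suc p) * (s\<^sup>2 / N)"
      using N by (intro mult_right_mono) auto
    also have "\<dots> = s\<^sup>2 / (8 * t)"
      using assms by (simp add: N_def del: of_nat_Suc)
    finally show ?thesis .
  qed
  finally show "\<bar>s\<bar> ^ p \<le> (1 + 8 * t * real (Suc p)) ^ p * exp (s\<^sup>2 / (8 * t))"
    using N by (simp add: N_def mult_left_mono)
qed

text \<open>The extra power of s strengthens the induction: the factor z in the recurrence is
  absorbed by raising p.\<close>

lemma hpoly_le_exp_square:
  assumes "t > 0"
  shows "\<exists>C. \<forall>s. \<bar>s\<bar> ^ p * \<bar>hpoly t k s\<bar> \<le> C * exp (s\<^sup>2 / (8 * t))"
  using assms
\<comment> \<open>The real argument of the induction rule is a dummy, since the bound concerns all s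
  at once.\<close>
proof (induction t k "0::real" arbitrary: p rule: hpoly.induct)
  case (1 t)
  then show ?case using power_le_exp_square[of t p] by simp
next
  case (2 t)
  obtain C where C: "\<bar>s\<bar> ^ Suc p \<le> C * exp (s\<^sup>2 / (8 * t))" for s
    using power_le_exp_square[OF 2, of "Suc p"] by blast
  have "\<bar>s\<bar> ^ p * \<bar>hpoly t (Suc 0) s\<bar> \<le> (C / (2 * t)) * exp (s\<^sup>2 / (8 * t))" for s
    using C[of s] 2 by (simp add: abs_mult field_simps)
  then show ?case by blast
next
  case (3 t k)
  obtain C D where C: "\<bar>s\<bar> ^ Suc p * \<bar>hpoly t (Suc k) s\<bar> \<le> C * exp (s\<^sup>2 / (8 * t))"
    and D: "\<bar>s\<bar> ^ p * \<bar>hpoly t k s\<bar> \<le> D * exp (s\<^sup>2 / (8 * t))" for s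
    using 3(1)[OF 3(3), of "Suc p"] 3(2)[OF 3(3), of p] by blast
  have "\<bar>s\<bar> ^ p * \<bar>hpoly t (Suc (Suc k)) s\<bar>
      \<le> ((C + real (Suc k) * D) / (2 * t)) * exp (s\<^sup>2 / (8 * t))" for s
  proof -
    have "\<bar>s\<bar> ^ p * \<bar>hpoly t (Suc (Suc k)) s\<bar>
        = \<bar>s\<bar> ^ p * \<bar>s * hpoly t (Suc k) s + real (Suc k) * hpoly t k s\<bar> / (2 * t)"
      using 3(3) unfolding hpoly.simps abs_divide abs_minus_cancel by simp
    also have "\<dots> \<le> \<bar>s\<bar> ^ p * (\<bar>s * hpoly t (Suc k) s\<bar> + \<bar>real (Suc k) * hpoly t k s\<bar>) / (2 * t)"
      using 3(3) by (intro divide_right_mono mult_left_mono abs_triangle_ineq) auto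
    also have "\<dots> = (\<bar>s\<bar> ^ Suc p * \<bar>hpoly t (Suc k) s\<bar>
        + real (Suc k) * (\<bar>s\<bar> ^ p * \<bar>hpoly t k s\<bar>)) / (2 * t)"
      by (simp add: abs_mult algebra_simps del: of_nat_Suc)
    also have "\<dots> \<le> (C * exp (s\<^sup>2 / (8 * t))
        + real (Suc k) * (D * exp (s\<^sup>2 / (8 * t)))) / (2 * t)"
      using 3(3) C[of s] D[of s]
      by (intro divide_right_mono add_mono mult_left_mono) auto
    finally show ?thesis by (simp add: algebra_simps)
  qed
  then show ?case by blast
qed

text \<open>Half of the decay rate 1 / (4 t) pays for the polynomial. What remains decays like the
  Gaussian at time 2 t, and sqrt 2 is the ratio of the two normalisations.\<close>

lemma hpoly_gauss_bound:
  assumes "t > 0"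
  obtains C where "\<And>s. \<bar>hpoly t k s * gauss t s\<bar> \<le> C * gauss (2 * t) s"
proof -
  obtain C where C: "\<bar>hpoly t k s\<bar> \<le> C * exp (s\<^sup>2 / (8 * t))" for s
    using hpoly_le_exp_square[OF assms, of 0 k] by auto
  have "\<bar>hpoly t k s * gauss t s\<bar> \<le> (C * sqrt 2) * gauss (2 * t) s" for s
  proof -
    have "\<bar>hpoly t k s * gauss t s\<bar> \<le> C * exp (s\<^sup>2 / (8 * t)) * gauss t s"
      unfolding abs_mult using C[of s] by (simp add: mult_right_mono)
    also have "\<dots> = C / sqrt (4 * pi * t) * (exp (s\<^sup>2 / (8 * t)) * exp (- s\<^sup>2 / (4 * t)))"
      using assms by (simp add: gauss_eq)
    also have "exp (s\<^sup>2 / (8 * t)) * exp (- s\<^sup>2 / (4 * t)) = exp (- s\<^sup>2 / (4 * (2 * t)))"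
      unfolding exp_add[symmetric] using assms by (simp add: field_simps)
    also have "C / sqrt (4 * pi * t) = C * sqrt 2 * (1 / sqrt (4 * pi * (2 * t)))"
    proof -
      have "sqrt (4 * pi * (2 * t)) = sqrt 2 * sqrt (4 * pi * t)"
        by (simp only: real_sqrt_mult[symmetric]) (simp add: mult_ac)
      then show ?thesis by simp
    qed
    also have "C * sqrt 2 * (1 / sqrt (4 * pi * (2 * t))) * exp (- s\<^sup>2 / (4 * (2 * t)))
        = C * sqrt 2 * gauss (2 * t) s"
      using gauss_eq[of "2 * t" s] assms by simp
    finally show ?thesis .
  qed
  then show ?thesis using that by blast
qed

section \<open>Expansion of monomials in Hermite polynomials\<close>

fun hcoef :: "nat \<Rightarrow> nat \<Rightarrow> real" where
  "hcoef 0 k = (if k = 0 then 1 else 0)"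
| "hcoef (Suc b) k = (case k of 0 \<Rightarrow> 0 | Suc i \<Rightarrow> - 2 * hcoef b i) - real (Suc k) * hcoef b (Suc k)"

lemma hcoef_eq_0: "b < k \<Longrightarrow> hcoef b k = 0"
  by (induction b arbitrary: k) (auto split: nat.split)

text \<open>Each multiplication by z moves k by exactly one, so b + k keeps its parity. This is the
  source of the gap of two orders in the second sum.\<close>

lemma hcoef_odd: "odd (b + k) \<Longrightarrow> hcoef b k = 0"
  by (induction b arbitrary: k) (auto split: nat.split intro: odd_pos)

lemma hcoef_diag: "hcoef b b = (- 2) ^ b"
  by (induction b) (auto simp: hcoef_eq_0)

text \<open>Multiplying by z either raises k, which increases b + k by two and costs a factor -2 t,
  or lowers k, which leaves b + k unchanged and costs no t. Hence the power of t depends only on b +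
  k.\<close>

lemma power_eq_sum_hpoly:
  assumes "t > 0"
  shows "z ^ b = (\<Sum>k\<le>b. hcoef b k * t ^ ((b + k) div 2) * hpoly t k z)"
proof (induction b)
  case (Suc b)
  let ?T = "\<lambda>n. t ^ (n div 2)"
  have T: "?T (Suc (Suc n)) = t * ?T n" for n by simp
  have "z ^ Suc b = (\<Sum>k\<le>b. hcoef b k * ?T (b + k) * (z * hpoly t k z))"
    by (simp add: Suc.IH sum_distrib_left mult_ac)
  also have "\<dots> = (\<Sum>k\<le>b. - 2 * hcoef b k * ?T (Suc (Suc (b + k))) * hpoly t (Suc k) z)
      - (\<Sum>k\<le>b. real k * hcoef b k * ?T (b + k) * hpoly t (k - 1) z)"
    unfolding mult_hpoly[OF assms] T sum_subtractf[symmetric]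
    by (intro sum.cong) (auto simp: algebra_simps)
  \<comment> \<open>The two added terms have k > b and vanish. After the shift of k, where the term
    k = 0 drops out, the range is that of degree \<open>Suc b\<close>.\<close>
  also have "(\<Sum>k\<le>b. real k * hcoef b k * ?T (b + k) * hpoly t (k - 1) z)
      = (\<Sum>k\<le>Suc (Suc b). real k * hcoef b k * ?T (b + k) * hpoly t (k - 1) z)"
    by (simp add: hcoef_eq_0)
  also have "\<dots> = (\<Sum>k\<le>Suc b. real (Suc k) * hcoef b (Suc k) * ?T (Suc b + k) * hpoly t k z)"
    by (subst sum.atMost_Suc_shift) simp
  also have "(\<Sum>k\<le>b. - 2 * hcoef b k * ?T (Suc (Suc (b + k))) * hpoly t (Suc k) z)
      = (\<Sum>k\<le>Suc b. (case k of 0 \<Rightarrow> 0 | Suc i \<Rightarrow> - 2 * hcoef b i) * ?T (Suc b + k) * hpoly t k z)"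
    by (subst sum.atMost_Suc_shift) simp
  finally show ?case
    unfolding sum_subtractf[symmetric] by (simp add: left_diff_distrib del: sum.atMost_Suc)
qed simp

text \<open>Binomial theorem, then the Hermite expansion of each power of z. The sum runs over pairs
  so that a product over coordinates becomes a sum over pairs of multi-indices.\<close>

lemma power_add_eq_sum_hpoly:
  assumes "t > 0"
  shows "(z + y) ^ a = (\<Sum>(k, c)\<in>{(k, c). k + c \<le> a}.
    real (a choose c) * hcoef (a - c) k * t ^ ((a - c + k) div 2) * hpoly t k z * y ^ c)"
proof -
  have "(z + y) ^ a = (\<Sum>c\<le>a. real (a choose c) * y ^ c * z ^ (a - c))"
    by (subst add.commute) (rule binomial_ring)
  also have "\<dots> = (\<Sum>c\<le>a. \<Sum>k\<le>a - c.
      real (a choose c) * hcoef (a - c) k * t ^ ((a - c + k) div 2) * hpoly t k z * y ^ c)"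
    by (subst power_eq_sum_hpoly[OF assms]) (simp add: sum_distrib_left mult_ac)
  also have "\<dots> = (\<Sum>(c, k)\<in>Sigma {..a} (\<lambda>c. {..a - c}).
      real (a choose c) * hcoef (a - c) k * t ^ ((a - c + k) div 2) * hpoly t k z * y ^ c)"
    by (subst sum.Sigma) auto
  also have "\<dots> = (\<Sum>(k, c)\<in>{(k, c). k + c \<le> a}.
      real (a choose c) * hcoef (a - c) k * t ^ ((a - c + k) div 2) * hpoly t k z * y ^ c)"
    by (intro sum.reindex_bij_witness[where i = prod.swap and j = prod.swap]) auto
  finally show ?thesis .
qed

subsection \<open>Derivatives of the heat kernel\<close>

text \<open>For t > 0 this is the derivative of order \<beta> of the heat kernel, given in closed
  form so that bounds and continuity can be read off coordinatewise.\<close>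

definition heat_ker :: "real \<Rightarrow> ('n::finite \<Rightarrow> nat) \<Rightarrow> real ^ 'n \<Rightarrow> real"
  where "heat_ker t \<beta> z = (\<Prod>j\<in>UNIV. hpoly t (\<beta> j) (z $ j) * gauss t (z $ j))"

definition heat_conv :: "real \<Rightarrow> ('n::finite \<Rightarrow> nat) \<Rightarrow> (real ^ 'n \<Rightarrow> complex) \<Rightarrow> real ^ 'n \<Rightarrow> complex"
  where "heat_conv t \<beta> \<psi> = (\<lambda>x. LINT y|lebesgue. heat_ker t \<beta> (x - y) *\<^sub>R \<psi> y)"

lemma heat_kernel_eq:
  fixes z :: "real ^ 'n::finite"
  assumes "t > 0"
  shows "heat_kernel t z = heat_ker t 0 z"
proof -
  have "heat_ker t 0 z = (1 / sqrt (4 * pi * t)) ^ CARD('n) * (\<Prod>j\<in>UNIV. exp (- (z $ j)\<^sup>2 / (4 * t)))"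
    unfolding heat_ker_def gauss_eq[OF assms] by (simp add: prod.distrib[symmetric] power_divide prod_dividef)
  also have "(\<Prod>j\<in>UNIV. exp (- (z $ j)\<^sup>2 / (4 * t))) = exp (- (norm z)\<^sup>2 / (4 * t))"
    by (simp add: exp_sum[symmetric] norm_vec_def L2_set_def sum_nonneg sum_divide_distrib sum_negf)
  also have "(1 / sqrt (4 * pi * t)) ^ CARD('n) = (4 * pi * t) powr (- real CARD('n) / 2)"
  proof -
    have "1 / sqrt (4 * pi * t) = (4 * pi * t) powr (- 1 / 2)"
      using assms by (simp add: powr_minus_divide powr_half_sqrt)
    then have "(1 / sqrt (4 * pi * t)) ^ CARD('n) = (4 * pi * t) powr (- 1 / 2 * real CARD('n))"
      using assms by (simp only: powr_powr[symmetric]) (simp add: powr_realpow)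
    then show ?thesis by simp
  qed
  finally show ?thesis unfolding heat_kernel_def by (rule sym)
qed

lemma heat_eq_heat_conv: "t > 0 \<Longrightarrow> heat t \<psi> = heat_conv t 0 \<psi>"
  by (simp add: heat_def heat_conv_def heat_kernel_eq)

lemma continuous_on_heat_ker:
  fixes \<beta> :: "'n::finite \<Rightarrow> nat"
  assumes "t > 0"
  shows "continuous_on UNIV (heat_ker t \<beta>)"
proof -
  have cont: "continuous_on UNIV (\<lambda>z. hpoly t k z * gauss t z)" for k
    using DERIV_isCont[OF hpoly_gauss_has_real_derivative[OF assms]]
    by (simp add: continuous_on_eq_continuous_at)
  have "continuous_on UNIV (\<lambda>z. hpoly t k (z $ j) * gauss t (z $ j))" for k and j :: 'n
    by (rule continuous_on_compose2[OF cont]) (auto intro: continuous_intros)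
  then show ?thesis
    unfolding heat_ker_def by (intro continuous_on_prod)
qed

lemma borel_measurable_heat_ker:
  "t > 0 \<Longrightarrow> heat_ker t \<beta> \<in> borel_measurable borel"
  by (rule borel_measurable_continuous_onI[OF continuous_on_heat_ker])

lemma heat_ker_bound:
  fixes \<beta> :: "'n::finite \<Rightarrow> nat"
  assumes "t > 0"
  obtains C where "C \<ge> 0" "\<And>z. \<bar>heat_ker t \<beta> z\<bar> \<le> C * (\<Prod>j\<in>UNIV. gauss (2 * t) (z $ j))"
proof -
  have "\<exists>C. \<forall>s. \<bar>hpoly t (\<beta> j) s * gauss t s\<bar> \<le> C * gauss (2 * t) s" for j
    using hpoly_gauss_bound[OF assms] by metis
  then obtain C where C: "\<bar>hpoly t (\<beta> j) s * gauss t s\<bar> \<le> C j * gauss (2 * t) s" for j s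
    by metis
  \<comment> \<open>Evaluating the bound at 0, where the Gaussian is positive, forces the
    sign.\<close>
  have C_nonneg: "C j \<ge> 0" for j
  proof -
    have "0 \<le> C j * gauss (2 * t) 0"
      using C[of j 0] by linarith
    moreover have "gauss (2 * t) 0 > 0"
      using assms by (simp add: normal_density_pos)
    ultimately show ?thesis
      by (simp add: zero_le_mult_iff)
  qed
  show ?thesis
  proof
    show "(\<Prod>j\<in>UNIV. C j) \<ge> 0" by (simp add: C_nonneg prod_nonneg)
    show "\<bar>heat_ker t \<beta> z\<bar> \<le> (\<Prod>j\<in>UNIV. C j) * (\<Prod>j\<in>UNIV. gauss (2 * t) (z $ j))" for z
      unfolding heat_ker_def abs_prod prod.distrib[symmetric]
      by (intro prod_mono conjI C abs_ge_zero)
  qed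
qed

lemma bounded_heat_ker:
  fixes \<beta> :: "'n::finite \<Rightarrow> nat"
  assumes "t > 0"
  obtains M where "\<And>z. \<bar>heat_ker t \<beta> z\<bar> \<le> M"
proof -
  obtain C where C: "C \<ge> 0" "\<And>z. \<bar>heat_ker t \<beta> z\<bar> \<le> C * (\<Prod>j\<in>UNIV. gauss (2 * t) (z $ j))"
    using heat_ker_bound[OF assms, of \<beta>] by blast
  have "gauss (2 * t) s \<le> 1 / sqrt (4 * pi * (2 * t))" for s
    using assms gauss_eq[of "2 * t" s] by (simp add: divide_right_mono)
  then have "(\<Prod>j\<in>UNIV. gauss (2 * t) (z $ j)) \<le> (1 / sqrt (4 * pi * (2 * t))) ^ CARD('n)" for z :: "real ^ 'n"
    using prod_mono[of UNIV "\<lambda>j. gauss (2 * t) (z $ j)" "\<lambda>_. 1 / sqrt (4 * pi * (2 * t))"] by simp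
  then have "\<bar>heat_ker t \<beta> z\<bar> \<le> C * (1 / sqrt (4 * pi * (2 * t))) ^ CARD('n)" for z
    using C(2)[of z] mult_left_mono[OF _ C(1)] order_trans by blast
  then show ?thesis by (rule that)
qed

lemma integrable_heat_ker:
  fixes \<beta> :: "'n::finite \<Rightarrow> nat"
  assumes "t > 0"
  shows "integrable lborel (heat_ker t \<beta>)"
proof -
  obtain C where C: "\<And>z. \<bar>heat_ker t \<beta> z\<bar> \<le> C * (\<Prod>j\<in>UNIV. gauss (2 * t) (z $ j))"
    using heat_ker_bound[OF assms] by metis
  let ?g = "\<lambda>z :: real ^ 'n. \<Prod>j\<in>UNIV. gauss (2 * t) (z $ j)"
  have meas: "?g \<in> borel_measurable lborel"
    by measurable
  have int1: "integrable lborel (gauss (2 * t))"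
    using assms by (intro integrable_normal_density) simp
  \<comment> \<open>The dominating function is a product over coordinates, so Tonelli reduces its
    integral to one-dimensional Gaussian integrals.\<close>
  have "(\<integral>\<^sup>+z. ennreal (norm (?g z)) \<partial>lborel)
      = (\<integral>\<^sup>+z. (\<Prod>b\<in>Basis. ennreal (gauss (2 * t) ((z :: real ^ 'n) \<bullet> b))) \<partial>lborel)"
  proof (rule nn_integral_cong)
    fix z :: "real ^ 'n"
    have Basis: "(Basis :: (real ^ 'n) set) = (\<lambda>j. axis j 1) ` UNIV"
      by (auto simp: Basis_vec_def)
    have inj: "inj (\<lambda>j :: 'n. axis j (1 :: real))"
      by (auto simp: inj_on_def axis_eq_axis)
    show "ennreal (norm (?g z)) = (\<Prod>b\<in>Basis. ennreal (gauss (2 * t) (z \<bullet> b)))"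
      by (simp add: Basis prod.reindex[OF inj] prod_ennreal prod_nonneg abs_of_nonneg inner_axis)
  qed
  also have "\<dots> = (\<Prod>b\<in>(Basis :: (real ^ 'n) set). \<integral>\<^sup>+s. ennreal (gauss (2 * t) s) \<partial>lborel)"
    by (rule nn_integral_lborel_prod) auto
  also have "\<dots> < \<infinity>"
    using int1 by (auto simp: integrable_iff_bounded power_less_top_ennreal)
  finally have "integrable lborel ?g"
    using meas by (simp add: integrable_iff_bounded)
  then have "integrable lborel (\<lambda>z. C * ?g z)"
    by simp
  then show ?thesis
    by (rule Bochner_Integration.integrable_bound)
      (use C borel_measurable_heat_ker[OF assms] in \<open>auto intro: order_trans[OF _ abs_ge_self]\<close>)
qed

section \<open>Integrability of the convolutions\<close>

lemma sigma_finite_lebesgue: "sigma_finite_measure (lebesgue :: 'a::euclidean_space measure)"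
proof -
  obtain A :: "'a set set" where "countable A" "A \<subseteq> sets lborel" "\<Union>A = space lborel"
      "\<forall>a\<in>A. emeasure lborel a \<noteq> \<infinity>"
    using lborel.sigma_finite_countable by blast
  then show ?thesis
    by unfold_locales (intro exI[of _ A], auto)
qed

text \<open>Young's inequality for two integrable factors: by translation invariance the x-integral
  of the absolute kernel does not depend on y, so Fubini applies to the joint integrand.\<close>

lemma integrable_heat_conv:
  fixes \<psi> :: "real ^ 'n::finite \<Rightarrow> complex"
  assumes "t > 0" and \<psi>: "integrable lebesgue \<psi>"
  shows "integrable lebesgue (heat_conv t \<beta> \<psi>)"
proof -
  let ?M = "lebesgue :: (real ^ 'n) measure"
  let ?K = "heat_ker t \<beta>"
  interpret sigma_finite_measure ?M by (rule sigma_finite_lebesgue)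
  interpret pair_sigma_finite ?M ?M ..
  have [measurable]: "?K \<in> borel_measurable borel"
    by (rule borel_measurable_heat_ker[OF assms(1)])
  have [measurable]: "\<psi> \<in> borel_measurable ?M"
    using \<psi> by simp
  have id[measurable]: "(\<lambda>x. x) \<in> ?M \<rightarrow>\<^sub>M borel"
    by (intro measurable_completion) simp
  have [measurable]: "fst \<in> ?M \<Otimes>\<^sub>M ?M \<rightarrow>\<^sub>M borel" "snd \<in> ?M \<Otimes>\<^sub>M ?M \<rightarrow>\<^sub>M borel"
    using measurable_compose[OF measurable_fst id] measurable_compose[OF measurable_snd id] by simp_all
  have K: "integrable ?M (\<lambda>x. ?K (x - y))"
    and K_int: "(LINT x|?M. \<bar>?K (x - y)\<bar>) = (LINT x|?M. \<bar>?K x\<bar>)" for y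
  proof -
    \<comment> \<open>Translation invariance is taken from Borel measure and then passed to its
      completion.\<close>
    have "integrable (distr lborel borel ((+) (- y))) ?K"
      using integrable_heat_ker[OF assms(1)] by (simp add: lborel_distr_plus)
    then have "integrable lborel (\<lambda>x. ?K (x - y))"
      by (subst (asm) integrable_distr_eq) auto
    then show "integrable ?M (\<lambda>x. ?K (x - y))"
      by (subst integrable_completion) auto
    have "(LINT x|lborel. \<bar>?K x\<bar>) = (LINT x|distr lborel borel ((+) (- y)). \<bar>?K x\<bar>)"
      by (simp add: lborel_distr_plus)
    also have "\<dots> = (LINT x|lborel. \<bar>?K (x - y)\<bar>)"
      by (subst integral_distr) auto
    finally show "(LINT x|?M. \<bar>?K (x - y)\<bar>) = (LINT x|?M. \<bar>?K x\<bar>)"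
      by (simp add: integral_completion)
  qed
  have "integrable (?M \<Otimes>\<^sub>M ?M) (\<lambda>(y, x). ?K (x - y) *\<^sub>R \<psi> y)"
  proof (rule Fubini_integrable)
    show "(\<lambda>(y, x). ?K (x - y) *\<^sub>R \<psi> y) \<in> borel_measurable (?M \<Otimes>\<^sub>M ?M)"
      unfolding split_beta' by measurable
    show "integrable ?M (\<lambda>y. LINT x|?M. norm (case (y, x) of (y, x) \<Rightarrow> ?K (x - y) *\<^sub>R \<psi> y))"
      using \<psi> by (simp add: K_int)
    show "AE y in ?M. integrable ?M (\<lambda>x. case (y, x) of (y, x) \<Rightarrow> ?K (x - y) *\<^sub>R \<psi> y)"
      using K by simp
  qed
  then show ?thesis
    unfolding heat_conv_def by (rule integrable_snd)
qed

subsection \<open>Derivatives of the heat semigroup\<close>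

text \<open>Along the axis j only the factor of coordinate j varies; \<open>?R\<close> collects the
  others, which \<beta> and its update at j share.\<close>

lemma heat_ker_has_real_derivative:
  fixes z :: "real ^ 'n::finite"
  assumes "t > 0"
  shows "((\<lambda>s. heat_ker t \<beta> (z + s *\<^sub>R axis j 1)) has_real_derivative
    heat_ker t (\<beta>(j := Suc (\<beta> j))) (z + s *\<^sub>R axis j 1)) (at s)"
proof -
  let ?R = "\<Prod>i\<in>UNIV - {j}. hpoly t (\<beta> i) (z $ i) * gauss t (z $ i)"
  have split: "heat_ker t \<gamma> (z + s *\<^sub>R axis j 1)
      = hpoly t (\<gamma> j) (z $ j + s) * gauss t (z $ j + s) * ?R"
    if "\<And>i. i \<noteq> j \<Longrightarrow> \<gamma> i = \<beta> i" for \<gamma> s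
    unfolding heat_ker_def by (subst prod.remove[of _ j]) (auto simp: axis_def that intro!: prod.cong)
  have "((\<lambda>s. z $ j + s) has_real_derivative 1) (at s)"
    by (auto intro!: derivative_eq_intros)
  from DERIV_chain2[OF hpoly_gauss_has_real_derivative[OF assms, of "\<beta> j"] this]
  have "((\<lambda>s. hpoly t (\<beta> j) (z $ j + s) * gauss t (z $ j + s) * ?R) has_real_derivative
      hpoly t (Suc (\<beta> j)) (z $ j + s) * gauss t (z $ j + s) * ?R) (at s)"
    by (intro DERIV_cmult_right) simp
  then show ?thesis
    by (simp add: split)
qed

lemma measurable_heat_ker_diff [measurable]:
  fixes x :: "real ^ 'n::finite"
  assumes "t > 0"
  shows "(\<lambda>y. heat_ker t \<beta> (x - y)) \<in> borel_measurable lebesgue"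
proof -
  have [measurable]: "heat_ker t \<beta> \<in> borel_measurable borel"
    by (rule borel_measurable_heat_ker[OF assms])
  show ?thesis
    by (intro measurable_completion) simp
qed

lemma integrable_heat_ker_scaleR:
  fixes \<psi> :: "real ^ 'n::finite \<Rightarrow> complex"
  assumes t: "t > 0" and \<psi>: "integrable lebesgue \<psi>"
  shows "integrable lebesgue (\<lambda>y. heat_ker t \<beta> (x - y) *\<^sub>R \<psi> y)"
proof -
  obtain M where M: "\<And>z. \<bar>heat_ker t \<beta> z\<bar> \<le> M"
    using bounded_heat_ker[OF t, of \<beta>] by blast
  have [measurable]: "\<psi> \<in> borel_measurable lebesgue"
    using \<psi> by simp
  show ?thesis
  proof (rule Bochner_Integration.integrable_bound)
    show "integrable lebesgue (\<lambda>y. M * norm (\<psi> y))"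
      using \<psi> by simp
    show "AE y in lebesgue. norm (heat_ker t \<beta> (x - y) *\<^sub>R \<psi> y) \<le> norm (M * norm (\<psi> y))"
      using order_trans[OF M abs_ge_self] by (auto simp: abs_mult intro!: mult_right_mono)
  qed (use t in measurable)
qed

text \<open>Differentiation under the integral sign: by the mean value inequality the difference
  quotients are bounded by a bound M for the differentiated kernel, so M |\<psi>| dominates.\<close>

lemma partial_deriv_heat_conv:
  fixes \<psi> :: "real ^ 'n::finite \<Rightarrow> complex"
  assumes t: "t > 0" and \<psi>: "integrable lebesgue \<psi>"
  shows "partial_deriv j (heat_conv t \<beta> \<psi>) = heat_conv t (\<beta>(j := Suc (\<beta> j))) \<psi>"
proof
  fix x :: "real ^ 'n"
  let ?\<beta> = "\<beta>(j := Suc (\<beta> j))" and ?e = "axis j 1 :: real ^ 'n"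
  let ?F = "\<lambda>s. heat_conv t \<beta> \<psi> (x + s *\<^sub>R ?e)" and ?D = "heat_conv t ?\<beta> \<psi> x"
  obtain M where M: "\<And>z. \<bar>heat_ker t ?\<beta> z\<bar> \<le> M"
    using bounded_heat_ker[OF t, of ?\<beta>] by blast
  have [measurable]: "\<psi> \<in> borel_measurable lebesgue"
    using \<psi> by simp
  let ?q = "\<lambda>h y. (heat_ker t \<beta> (x - y + h *\<^sub>R ?e) - heat_ker t \<beta> (x - y)) / h"
  have q_eq: "?q h y = (heat_ker t \<beta> (x + h *\<^sub>R ?e - y) - heat_ker t \<beta> (x - y)) / h" for h y
    by (simp add: algebra_simps)
  have q_meas [measurable]: "?q h \<in> borel_measurable lebesgue" for h
    unfolding q_eq using t by measurable
  have q_bound: "\<bar>?q h y\<bar> \<le> M" if "h \<noteq> 0" for h y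
  proof -
    have "norm (heat_ker t \<beta> (x - y + h *\<^sub>R ?e) - heat_ker t \<beta> (x - y + 0 *\<^sub>R ?e)) \<le> M * norm (h - 0)"
      by (rule field_differentiable_bound[OF convex_UNIV heat_ker_has_real_derivative[OF t]]) (use M in auto)
    then show ?thesis
      using that by (simp add: divide_le_eq)
  qed
  have lim: "((\<lambda>h. (?F h - ?F 0) /\<^sub>R h) \<longlongrightarrow> ?D) (at 0)"
    \<comment> \<open>Dominated convergence is a statement about sequences, so the limit is tested
      along null sequences avoiding 0.\<close>
    unfolding tendsto_at_iff_sequentially comp_def
  proof (intro allI impI)
    fix X :: "nat \<Rightarrow> real"
    assume X0: "\<forall>i. X i \<in> UNIV - {0}" and X: "X \<longlonglongrightarrow> 0"
    have "(\<lambda>i. LINT y|lebesgue. ?q (X i) y *\<^sub>R \<psi> y) \<longlonglongrightarrow> (LINT y|lebesgue. heat_ker t ?\<beta> (x - y) *\<^sub>R \<psi> y)"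
    proof (rule integral_dominated_convergence)
      show "integrable lebesgue (\<lambda>y. M * norm (\<psi> y))"
        using \<psi> by simp
      show "AE y in lebesgue. norm (?q (X i) y *\<^sub>R \<psi> y) \<le> M * norm (\<psi> y)" for i
        unfolding norm_scaleR real_norm_def using X0 by (intro AE_I2 mult_right_mono q_bound) auto
      show "AE y in lebesgue. (\<lambda>i. ?q (X i) y *\<^sub>R \<psi> y) \<longlonglongrightarrow> heat_ker t ?\<beta> (x - y) *\<^sub>R \<psi> y"
      proof (rule AE_I2)
        fix y
        have "((\<lambda>h. ?q h y) \<longlongrightarrow> heat_ker t ?\<beta> (x - y)) (at 0)"
          using heat_ker_has_real_derivative[OF t, of \<beta> "x - y" j 0]
          by (simp add: has_field_derivative_iff)
        then have "(\<lambda>i. ?q (X i) y) \<longlonglongrightarrow> heat_ker t ?\<beta> (x - y)"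
          using X0 X unfolding tendsto_at_iff_sequentially comp_def by blast
        then show "(\<lambda>i. ?q (X i) y *\<^sub>R \<psi> y) \<longlonglongrightarrow> heat_ker t ?\<beta> (x - y) *\<^sub>R \<psi> y"
          by (intro tendsto_intros)
      qed
    qed (use t in measurable)
    moreover have "(LINT y|lebesgue. ?q (X i) y *\<^sub>R \<psi> y) = (?F (X i) - ?F 0) /\<^sub>R X i" for i
    proof -
      have "(LINT y|lebesgue. ?q (X i) y *\<^sub>R \<psi> y)
          = (LINT y|lebesgue. (heat_ker t \<beta> (x + X i *\<^sub>R ?e - y) *\<^sub>R \<psi> y - heat_ker t \<beta> (x - y) *\<^sub>R \<psi> y) /\<^sub>R X i)"
        unfolding q_eq unfolding scaleR_diff_left[symmetric] scaleR_scaleR divide_inverse_commute ..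
      then show ?thesis
        using integrable_heat_ker_scaleR[OF t \<psi>] by (simp add: heat_conv_def)
    qed
    ultimately show "(\<lambda>i. (?F (X i) - ?F 0) /\<^sub>R X i) \<longlonglongrightarrow> ?D"
      by (simp add: heat_conv_def)
  qed
  have "(?F has_vector_derivative ?D) (at 0)"
    unfolding has_vector_derivative_def has_derivative_at
  proof
    have "norm ((?F h - ?F 0) /\<^sub>R h - ?D) = norm (?F (0 + h) - ?F 0 - h *\<^sub>R ?D) / norm h"
      if "h \<noteq> 0" for h
    proof -
      have "(?F h - ?F 0) /\<^sub>R h - ?D = (?F (0 + h) - ?F 0 - h *\<^sub>R ?D) /\<^sub>R h"
        using that by (simp add: scaleR_diff_right)
      then show ?thesis
        by (simp add: divide_inverse_commute)
    qed
    moreover have "((\<lambda>h. norm ((?F h - ?F 0) /\<^sub>R h - ?D)) \<longlongrightarrow> 0) (at 0)"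
      using lim LIM_zero tendsto_norm_zero by blast
    ultimately show "(\<lambda>h. norm (?F (0 + h) - ?F 0 - h *\<^sub>R ?D) / norm h) \<midarrow>0\<rightarrow> 0"
      by (subst (asm) Lim_cong_within) auto
  qed (rule bounded_linear_scaleR_left)
  then show "partial_deriv j (heat_conv t \<beta> \<psi>) x = heat_conv t ?\<beta> \<psi> x"
    unfolding partial_deriv_def by (rule vector_derivative_at)
qed

lemma partial_deriv_power_heat_conv:
  assumes "t > 0" and "integrable lebesgue \<psi>"
  shows "(partial_deriv j ^^ k) (heat_conv t \<beta> \<psi>) = heat_conv t (\<beta>(j := \<beta> j + k)) \<psi>"
  by (induction k) (simp_all add: partial_deriv_heat_conv[OF assms] fun_upd_def if_distrib cong: if_cong)

text \<open>Each coordinate is differentiated in one block. Distinctness of the list means that its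
  entry of the multi-index is still 0 when the block is applied.\<close>

lemma mi_deriv_heat:
  fixes \<psi> :: "real ^ 'n::finite \<Rightarrow> complex"
  assumes t: "t > 0" and \<psi>: "integrable lebesgue \<psi>"
  shows "mi_deriv \<beta> (heat t \<psi>) = heat_conv t \<beta> \<psi>"
proof -
  have "foldr (\<lambda>j. partial_deriv j ^^ \<beta> j) js (heat_conv t 0 \<psi>)
      = heat_conv t (\<lambda>j. if j \<in> set js then \<beta> j else 0) \<psi>" if "distinct js" for js
    using that
  proof (induction js)
    case Nil
    then show ?case by (simp add: zero_fun_def)
  next
    case (Cons i js)
    have "(\<lambda>j. if j \<in> set js then \<beta> j else 0)(i := 0 + \<beta> i) = (\<lambda>j. if j \<in> set (i # js) then \<beta> j else 0)"
      by auto
    with Cons show ?case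
      by (simp add: partial_deriv_power_heat_conv[OF t \<psi>])
  qed
  from this[OF coords(1)] show ?thesis
    by (simp add: mi_deriv_def heat_eq_heat_conv[OF t] coords(2))
qed

subsection \<open>Moments\<close>

definition moment_coef :: "('n::finite \<Rightarrow> nat) \<Rightarrow> ('n \<Rightarrow> nat) \<Rightarrow> ('n \<Rightarrow> nat) \<Rightarrow> real"
  where "moment_coef \<alpha> \<beta> \<gamma> = (\<Prod>j\<in>UNIV. real (\<alpha> j choose \<gamma> j) * hcoef (\<alpha> j - \<gamma> j) (\<beta> j))"

text \<open>Halving is done per coordinate; where the coefficient is nonzero every summand is even,
  so nothing is lost to rounding.\<close>

definition moment_exp :: "('n::finite \<Rightarrow> nat) \<Rightarrow> ('n \<Rightarrow> nat) \<Rightarrow> ('n \<Rightarrow> nat) \<Rightarrow> nat"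
  where "moment_exp \<alpha> \<beta> \<gamma> = (\<Sum>j\<in>UNIV. (\<alpha> j - \<gamma> j + \<beta> j) div 2)"

lemma finite_mi_pairs: "finite {(\<beta>, \<gamma>). \<beta> + \<gamma> \<le> (\<alpha> :: 'n::finite \<Rightarrow> nat)}"
proof (rule finite_subset)
  show "{(\<beta>, \<gamma>). \<beta> + \<gamma> \<le> \<alpha>} \<subseteq> {\<beta>. \<beta> \<le> \<alpha>} \<times> {\<gamma>. \<gamma> \<le> \<alpha>}"
    using mi_add_le(1,2) by fastforce
qed (simp add: finite_mi_le)

text \<open>Expand each coordinate and multiply out: choosing a pair (k, c) in every coordinate
  amounts to choosing \<beta> and \<gamma> with \<beta> + \<gamma> \<le> \<alpha>. The Gaussian
  factors complete the Hermite products to \<open>heat_ker\<close>.\<close>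

lemma mi_pow_mult_heat_ker:
  fixes z y :: "real ^ 'n::finite"
  assumes "t > 0"
  shows "mi_pow (z + y) \<alpha> * heat_ker t 0 z = (\<Sum>(\<beta>, \<gamma>)\<in>{(\<beta>, \<gamma>). \<beta> + \<gamma> \<le> \<alpha>}.
    moment_coef \<alpha> \<beta> \<gamma> * t ^ moment_exp \<alpha> \<beta> \<gamma> * heat_ker t \<beta> z * mi_pow y \<gamma>)"
proof -
  let ?A = "\<lambda>j. {(k, c). k + c \<le> \<alpha> j}"
  let ?f = "\<lambda>j (k, c). real (\<alpha> j choose c) * hcoef (\<alpha> j - c) k * t ^ ((\<alpha> j - c + k) div 2) *
    hpoly t k (z $ j) * y $ j ^ c"
  have fin: "finite (?A j)" for j
    by (rule finite_subset[of _ "{..\<alpha> j} \<times> {..\<alpha> j}"]) auto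
  have "mi_pow (z + y) \<alpha> * heat_ker t 0 z
      = (\<Prod>j\<in>UNIV. (\<Sum>p\<in>?A j. ?f j p)) * (\<Prod>j\<in>UNIV. gauss t (z $ j))"
    by (simp add: mi_pow_def heat_ker_def power_add_eq_sum_hpoly[OF assms])
  also have "(\<Prod>j\<in>UNIV. (\<Sum>p\<in>?A j. ?f j p)) = (\<Sum>p\<in>PiE UNIV ?A. \<Prod>j\<in>UNIV. ?f j (p j))"
    by (rule prod_sum_PiE) (use fin in auto)
  also have "\<dots> = (\<Sum>(\<beta>, \<gamma>)\<in>{(\<beta>, \<gamma>). \<beta> + \<gamma> \<le> \<alpha>}. \<Prod>j\<in>UNIV. ?f j (\<beta> j, \<gamma> j))"
    by (rule sum.reindex_bij_witness[where i = "\<lambda>(\<beta>, \<gamma>) j. (\<beta> j, \<gamma> j)"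
          and j = "\<lambda>p. (\<lambda>j. fst (p j), \<lambda>j. snd (p j))"])
      (auto simp: le_fun_def PiE_iff split_beta)
  also have "\<dots> * (\<Prod>j\<in>UNIV. gauss t (z $ j)) = (\<Sum>(\<beta>, \<gamma>)\<in>{(\<beta>, \<gamma>). \<beta> + \<gamma> \<le> \<alpha>}.
      moment_coef \<alpha> \<beta> \<gamma> * t ^ moment_exp \<alpha> \<beta> \<gamma> * heat_ker t \<beta> z * mi_pow y \<gamma>)"
    unfolding sum_distrib_right
    by (intro sum.cong) (auto simp: moment_coef_def moment_exp_def power_sum heat_ker_def
        mi_pow_def prod.distrib)
  finally show ?thesis .
qed

lemma integrable_mi_mult:
  assumes "\<phi> \<in> L1w (mi_size \<alpha>)" and "\<beta> + \<gamma> \<le> \<alpha>"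
  shows "integrable lebesgue (mi_mult \<gamma> \<phi>)"
proof -
  have "mi_size \<gamma> \<le> mi_size \<alpha>"
    using mi_add_le(2)[OF assms(2)] by (auto simp: mi_size_def le_fun_def intro: sum_mono)
  then show ?thesis
    using assms(1) by (simp add: L1w_def)
qed

text \<open>The kernel expansion is applied with z = x - y and integrated term by term. Since
  \<gamma> \<le> \<alpha>, every weighted function that occurs is integrable.\<close>

lemma mi_mult_heat:
  fixes \<phi> :: "real ^ 'n::finite \<Rightarrow> complex"
  assumes t: "t > 0" and \<phi>: "\<phi> \<in> L1w (mi_size \<alpha>)"
  shows "mi_mult \<alpha> (heat t \<phi>) x = (\<Sum>(\<beta>, \<gamma>)\<in>{(\<beta>, \<gamma>). \<beta> + \<gamma> \<le> \<alpha>}.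
    (moment_coef \<alpha> \<beta> \<gamma> * t ^ moment_exp \<alpha> \<beta> \<gamma>) *\<^sub>R heat_conv t \<beta> (mi_mult \<gamma> \<phi>) x)"
proof -
  let ?S = "{(\<beta>, \<gamma>). \<beta> + \<gamma> \<le> \<alpha>}"
  let ?c = "\<lambda>\<beta> \<gamma>. moment_coef \<alpha> \<beta> \<gamma> * t ^ moment_exp \<alpha> \<beta> \<gamma>"
  note int = integrable_mi_mult[OF \<phi>]
  have "mi_mult \<alpha> (heat t \<phi>) x = (LINT y|lebesgue. mi_pow x \<alpha> *\<^sub>R heat_ker t 0 (x - y) *\<^sub>R \<phi> y)"
    by (simp add: mi_mult_def heat_eq_heat_conv[OF t] heat_conv_def del: scaleR_scaleR)
  also have "\<dots> = (LINT y|lebesgue. (\<Sum>(\<beta>, \<gamma>)\<in>?S.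
      ?c \<beta> \<gamma> *\<^sub>R heat_ker t \<beta> (x - y) *\<^sub>R mi_mult \<gamma> \<phi> y))"
  proof (rule Bochner_Integration.integral_cong[OF refl])
    fix y
    have "mi_pow x \<alpha> * heat_ker t 0 (x - y)
        = (\<Sum>(\<beta>, \<gamma>)\<in>?S. ?c \<beta> \<gamma> * heat_ker t \<beta> (x - y) * mi_pow y \<gamma>)"
      using mi_pow_mult_heat_ker[OF t, of "x - y" y \<alpha>] by simp
    then show "mi_pow x \<alpha> *\<^sub>R heat_ker t 0 (x - y) *\<^sub>R \<phi> y
        = (\<Sum>(\<beta>, \<gamma>)\<in>?S. ?c \<beta> \<gamma> *\<^sub>R heat_ker t \<beta> (x - y) *\<^sub>R mi_mult \<gamma> \<phi> y)"
      unfolding scaleR_scaleR by (simp add: scaleR_sum_left split_beta mi_mult_def mult_ac)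
  qed
  also have "\<dots> = (\<Sum>(\<beta>, \<gamma>)\<in>?S. ?c \<beta> \<gamma> *\<^sub>R heat_conv t \<beta> (mi_mult \<gamma> \<phi>) x)"
    unfolding split_beta
    by (subst Bochner_Integration.integral_sum)
      (use int in \<open>auto simp: heat_conv_def intro!: integrable_scaleR_right integrable_heat_ker_scaleR[OF t]
        simp del: scaleR_scaleR\<close>)
  finally show ?thesis .
qed

section \<open>Matching the expansion with the two sums\<close>

lemma moment_coef_main:
  fixes \<alpha> :: "'n::finite \<Rightarrow> nat"
  assumes "\<beta> + \<gamma> = \<alpha>"
  shows "moment_coef \<alpha> \<beta> \<gamma> = mi_fact \<alpha> / (mi_fact \<beta> * mi_fact \<gamma>) * (- 2) ^ mi_size \<beta>"
    and "moment_exp \<alpha> \<beta> \<gamma> = mi_size \<beta>"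
proof -
  have \<alpha>: "\<alpha> j = \<beta> j + \<gamma> j" for j
    using assms by auto
  have "real (\<beta> j + \<gamma> j choose \<gamma> j) = fact (\<alpha> j) / (fact (\<beta> j) * fact (\<gamma> j))" for j
    using binomial_fact[of "\<gamma> j" "\<beta> j + \<gamma> j"] by (simp add: \<alpha> mult_ac)
  then show "moment_coef \<alpha> \<beta> \<gamma> = mi_fact \<alpha> / (mi_fact \<beta> * mi_fact \<gamma>) * (- 2) ^ mi_size \<beta>"
    by (simp add: moment_coef_def \<alpha> hcoef_diag mi_fact_def mi_size_def power_sum prod.distrib
        prod_dividef)
  show "moment_exp \<alpha> \<beta> \<gamma> = mi_size \<beta>"
    by (simp add: moment_exp_def mi_size_def \<alpha>)
qed

text \<open>A nonzero coefficient makes every coordinate contribution even, so the exponent l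
  satisfies 2 l + |\<gamma>| = |\<alpha>| + |\<beta>| exactly.\<close>

lemma idx_rest_moment_exp:
  fixes \<alpha> :: "'n::finite \<Rightarrow> nat"
  assumes le: "\<beta> + \<gamma> \<le> \<alpha>" and ne: "\<beta> + \<gamma> \<noteq> \<alpha>" and nz: "moment_coef \<alpha> \<beta> \<gamma> \<noteq> 0"
  shows "(moment_exp \<alpha> \<beta> \<gamma>, \<beta>, \<gamma>) \<in> idx_rest \<alpha>"
proof -
  have le': "\<beta> j + \<gamma> j \<le> \<alpha> j" for j
    using le_funD[OF le, of j] by simp
  have "even (\<alpha> j - \<gamma> j + \<beta> j)" for j
    using nz hcoef_odd[of "\<alpha> j - \<gamma> j" "\<beta> j"] by (auto simp: moment_coef_def)
  then have "2 * ((\<alpha> j - \<gamma> j + \<beta> j) div 2) + \<gamma> j = \<alpha> j + \<beta> j" for j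
    using le'[of j] by (metis add.assoc add.commute dvd_mult_div_cancel le_add_diff_inverse2 add_leD2)
  then have "(\<Sum>j\<in>UNIV. 2 * ((\<alpha> j - \<gamma> j + \<beta> j) div 2) + \<gamma> j) = (\<Sum>j\<in>UNIV. \<alpha> j + \<beta> j)"
    by simp
  then have eq: "2 * moment_exp \<alpha> \<beta> \<gamma> + mi_size \<gamma> = mi_size \<alpha> + mi_size \<beta>"
    by (simp add: sum.distrib moment_exp_def mi_size_def sum_distrib_left)
  obtain i where "(\<beta> + \<gamma>) i \<noteq> \<alpha> i"
    using ne by (auto simp: fun_eq_iff)
  then have "\<beta> i + \<gamma> i < \<alpha> i"
    using le'[of i] by simp
  then have "(\<Sum>j\<in>UNIV. \<beta> j + \<gamma> j) < (\<Sum>j\<in>UNIV. \<alpha> j)"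
    using le' by (intro sum_strict_mono_ex1) auto
  then have "mi_size \<beta> + mi_size \<gamma> < mi_size \<alpha>"
    by (simp add: mi_size_def sum.distrib)
  moreover have "mi_size (\<beta> + \<gamma>) = mi_size \<beta> + mi_size \<gamma>"
    by (simp add: mi_size_def sum.distrib)
  \<comment> \<open>The exact equation gives |\<alpha>| - |\<beta> + \<gamma>| = 2 (l - |\<beta>|).
    This is positive and even, hence at least 2, and l exceeds |\<beta>|.\<close>
  moreover have "mi_size \<beta> + mi_size \<gamma> + 2 \<le> mi_size \<alpha>" "mi_size \<beta> + 1 \<le> moment_exp \<alpha> \<beta> \<gamma>"
    using eq calculation(1) by presburger+
  ultimately show ?thesis
    unfolding idx_rest_def using eq le by auto
qed

text \<open>The parity of the Hermite coefficients forces \<open>2 * l = |\<alpha>| + |\<beta>| - |\<gamma>|\<close> in every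
  nonzero term, so that only one \<open>l\<close> contributes for given \<open>\<beta>\<close> and \<open>\<gamma>\<close>.\<close>

definition remainder_coef :: "('n::finite \<Rightarrow> nat) \<Rightarrow> nat \<Rightarrow> ('n \<Rightarrow> nat) \<Rightarrow> ('n \<Rightarrow> nat) \<Rightarrow> real"
  where "remainder_coef \<alpha> l \<beta> \<gamma> = (if l = moment_exp \<alpha> \<beta> \<gamma> then moment_coef \<alpha> \<beta> \<gamma> else 0)"

text \<open>Both sums are cut down to their terms with nonzero coefficient; there l is determined by
  \<beta> and \<gamma>, and forgetting it is a bijection.\<close>

lemma sum_idx_rest:
  fixes D :: "('n::finite \<Rightarrow> nat) \<Rightarrow> ('n \<Rightarrow> nat) \<Rightarrow> complex"
  shows "(\<Sum>(l, \<beta>, \<gamma>)\<in>idx_rest \<alpha>. remainder_coef \<alpha> l \<beta> \<gamma> *\<^sub>R t ^ l *\<^sub>R D \<beta> \<gamma>)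
    = (\<Sum>(\<beta>, \<gamma>)\<in>{(\<beta>, \<gamma>). \<beta> + \<gamma> \<le> \<alpha> \<and> \<beta> + \<gamma> \<noteq> \<alpha>}.
        (moment_coef \<alpha> \<beta> \<gamma> * t ^ moment_exp \<alpha> \<beta> \<gamma>) *\<^sub>R D \<beta> \<gamma>)"
proof -
  let ?nz = "\<lambda>\<beta> \<gamma>. moment_coef \<alpha> \<beta> \<gamma> \<noteq> 0"
  have le: "\<beta> + \<gamma> \<le> \<alpha>" if "(l, \<beta>, \<gamma>) \<in> idx_rest \<alpha>" for l \<beta> \<gamma>
    using that by (simp add: idx_rest_def)
  have ne: "(l, \<beta>, \<gamma>) \<notin> idx_rest (\<beta> + \<gamma>)" for l and \<beta> \<gamma> :: "'n \<Rightarrow> nat"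
    by (simp add: idx_rest_def)
  have "(\<Sum>(l, \<beta>, \<gamma>)\<in>idx_rest \<alpha>. remainder_coef \<alpha> l \<beta> \<gamma> *\<^sub>R t ^ l *\<^sub>R D \<beta> \<gamma>)
      = (\<Sum>(l, \<beta>, \<gamma>)\<in>{(l, \<beta>, \<gamma>). (l, \<beta>, \<gamma>) \<in> idx_rest \<alpha> \<and> l = moment_exp \<alpha> \<beta> \<gamma> \<and> ?nz \<beta> \<gamma>}.
          remainder_coef \<alpha> l \<beta> \<gamma> *\<^sub>R t ^ l *\<^sub>R D \<beta> \<gamma>)"
    by (rule sum.mono_neutral_right) (auto simp: finite_idx_rest remainder_coef_def split: if_splits)
  also have "\<dots> = (\<Sum>(\<beta>, \<gamma>)\<in>{(\<beta>, \<gamma>). \<beta> + \<gamma> \<le> \<alpha> \<and> \<beta> + \<gamma> \<noteq> \<alpha> \<and> ?nz \<beta> \<gamma>}.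
      (moment_coef \<alpha> \<beta> \<gamma> * t ^ moment_exp \<alpha> \<beta> \<gamma>) *\<^sub>R D \<beta> \<gamma>)"
    by (rule sum.reindex_bij_witness[where j = snd
          and i = "\<lambda>(\<beta>, \<gamma>). (moment_exp \<alpha> \<beta> \<gamma>, \<beta>, \<gamma>)"])
      (auto simp: remainder_coef_def idx_rest_moment_exp ne dest: le)
  also have "\<dots> = (\<Sum>(\<beta>, \<gamma>)\<in>{(\<beta>, \<gamma>). \<beta> + \<gamma> \<le> \<alpha> \<and> \<beta> + \<gamma> \<noteq> \<alpha>}.
      (moment_coef \<alpha> \<beta> \<gamma> * t ^ moment_exp \<alpha> \<beta> \<gamma>) *\<^sub>R D \<beta> \<gamma>)"
    by (rule sum.mono_neutral_left) (auto intro: finite_subset[OF _ finite_mi_pairs[of \<alpha>]])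
  finally show ?thesis .
qed

lemma mi_mult_heat_diff:
  fixes \<phi> :: "real ^ 'n::finite \<Rightarrow> complex"
  assumes t: "t > 0" and \<phi>: "\<phi> \<in> L1w (mi_size \<alpha>)"
  shows "mi_mult \<alpha> (heat t \<phi>) x - heat t (mi_mult \<alpha> \<phi>) x
    = remainder (remainder_coef \<alpha>) \<alpha> t \<phi> x"
proof -
  let ?T = "\<lambda>(\<beta>, \<gamma>). (moment_coef \<alpha> \<beta> \<gamma> * t ^ moment_exp \<alpha> \<beta> \<gamma>) *\<^sub>R heat_conv t \<beta> (mi_mult \<gamma> \<phi>) x"
  let ?R = "{(\<beta>, \<gamma>). \<beta> + \<gamma> \<le> \<alpha> \<and> \<beta> + \<gamma> \<noteq> \<alpha>}"
  have conv: "mi_deriv \<beta> (heat t (mi_mult \<gamma> \<phi>)) = heat_conv t \<beta> (mi_mult \<gamma> \<phi>)"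
    if "\<beta> + \<gamma> \<le> \<alpha>" for \<beta> \<gamma>
    by (rule mi_deriv_heat[OF t integrable_mi_mult[OF \<phi> that]])
  \<comment> \<open>The pair (0, \<alpha>) yields the subtracted term, the other pairs with \<beta>
    + \<gamma> = \<alpha> the first sum, and the remaining pairs the second.\<close>
  have S: "{(\<beta>, \<gamma>). \<beta> + \<gamma> \<le> \<alpha>} = insert (0, \<alpha>) (idx_main \<alpha> \<union> ?R)"
    by (auto simp: idx_main_def)
  have finR: "finite ?R"
    by (rule finite_subset[OF _ finite_mi_pairs[of \<alpha>]]) auto
  have "mi_mult \<alpha> (heat t \<phi>) x = ?T (0, \<alpha>) + (sum ?T (idx_main \<alpha>) + sum ?T ?R)"
    unfolding mi_mult_heat[OF t \<phi>] S
    by (subst sum.insert, use finR finite_idx_main[of \<alpha>] in \<open>auto simp: idx_main_def\<close>)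
      (subst sum.union_disjoint, use finR finite_idx_main[of \<alpha>] in \<open>auto simp: idx_main_def\<close>)
  also have "?T (0, \<alpha>) = heat t (mi_mult \<alpha> \<phi>) x"
    using moment_coef_main[of 0 \<alpha> \<alpha>]
    by (simp add: heat_eq_heat_conv[OF t] mi_fact_def mi_size_def)
  also have "sum ?T (idx_main \<alpha>) = (\<Sum>(\<beta>, \<gamma>)\<in>idx_main \<alpha>. (mi_fact \<alpha> / (mi_fact \<beta> * mi_fact \<gamma>)) *\<^sub>R
        (- 2 * t) ^ mi_size \<beta> *\<^sub>R mi_deriv \<beta> (heat t (mi_mult \<gamma> \<phi>)) x)"
    unfolding power_mult_distrib
    by (intro sum.cong) (auto simp: idx_main_def moment_coef_main conv)
  also have "sum ?T ?R = (\<Sum>(l, \<beta>, \<gamma>)\<in>idx_rest \<alpha>. remainder_coef \<alpha> l \<beta> \<gamma> *\<^sub>R t ^ l *\<^sub>R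
        mi_deriv \<beta> (heat t (mi_mult \<gamma> \<phi>)) x)"
    unfolding sum_idx_rest by (intro sum.cong) (auto simp: conv)
  finally show ?thesis
    by (simp add: remainder_def)
qed

theorem theorem2p8:
  fixes m :: nat and \<alpha> :: "'n::finite \<Rightarrow> nat"
  assumes "m > 0" and "mi_size \<alpha> = m"
  shows "\<exists>C :: nat \<Rightarrow> ('n \<Rightarrow> nat) \<Rightarrow> ('n \<Rightarrow> nat) \<Rightarrow> real.
    \<forall>\<phi> \<in> (L1w m :: (real ^ 'n \<Rightarrow> complex) set). \<forall>t>0.
      integrable lebesgue (mi_mult \<alpha> (heat t \<phi>)) \<and>
      integrable lebesgue (heat t (mi_mult \<alpha> \<phi>)) \<and>
      integrable lebesgue (remainder C \<alpha> t \<phi>) \<and>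
      (AE x in lebesgue.
        mi_mult \<alpha> (heat t \<phi>) x - heat t (mi_mult \<alpha> \<phi>) x = remainder C \<alpha> t \<phi> x)"
\<comment> \<open>The witness is \<open>remainder_coef \<alpha>\<close>, which depends on \<alpha>
  alone; it is fixed by unification with the final \<open>show\<close>.\<close>
proof (intro exI ballI allI impI)
  fix \<phi> :: "real ^ 'n \<Rightarrow> complex" and t :: real
  assume \<phi>: "\<phi> \<in> L1w m" and t: "t > 0"
  then have \<phi>': "\<phi> \<in> L1w (mi_size \<alpha>)"
    by (simp add: assms(2))
  note diff = mi_mult_heat_diff[OF t \<phi>']
  have int: "integrable lebesgue (heat_conv t \<beta> (mi_mult \<gamma> \<phi>))" if "\<beta> + \<gamma> \<le> \<alpha>" for \<beta> \<gamma>
    by (rule integrable_heat_conv[OF t integrable_mi_mult[OF \<phi>' that]])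
  have int1: "integrable lebesgue (mi_mult \<alpha> (heat t \<phi>))"
    unfolding mi_mult_heat[OF t \<phi>', abs_def] split_beta
    by (intro Bochner_Integration.integrable_sum integrable_scaleR_right int) auto
  have int2: "integrable lebesgue (heat t (mi_mult \<alpha> \<phi>))"
    using int[of 0 \<alpha>] by (simp add: heat_eq_heat_conv[OF t])
  \<comment> \<open>The identity holds at every point, so the remainder inherits integrability from
    the difference.\<close>
  have "integrable lebesgue (remainder (remainder_coef \<alpha>) \<alpha> t \<phi>)"
    using Bochner_Integration.integrable_diff[OF int1 int2] unfolding diff .
  with int1 int2 show "integrable lebesgue (mi_mult \<alpha> (heat t \<phi>)) \<and>
      integrable lebesgue (heat t (mi_mult \<alpha> \<phi>)) \<and>
      integrable lebesgue (remainder (remainder_coef \<alpha>) \<alpha> t \<phi>) \<and>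
      (AE x in lebesgue.
        mi_mult \<alpha> (heat t \<phi>) x - heat t (mi_mult \<alpha> \<phi>) x = remainder (remainder_coef \<alpha>) \<alpha> t \<phi> x)"
    by (simp add: diff)
qed

end
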